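(* Let $\Sigma$ be a many-sorted signature with $|\mathcal{S}_\Sigma|<\aleph_0$. Let $\mathbb{A}$ be a $\Sigma$-structure with $\max\{|\sigma^{\mathbb{A}}|:\sigma\in\mathcal{S}_\Sigma\}\ge\aleph_0$, let $\kappa$ be a cardinal with $\max\{|\Sigma|,\aleph_0\}\le\kappa\le\min\{|\sigma^{\mathbb{A}}|:\sigma\in\mathcal{S}^{\ge}_{\mathbb{A}}\}$, and for each $\sigma\in\mathcal{S}_\Sigma$ let $A_\sigma\subseteq\sigma^{\mathbb{A}}$ with $|A_\sigma|\le\kappa$. Then there is an elementary substructure $\mathbb{B}$ of $\mathbb{A}$ such that $\sigma^{\mathbb{B}}=\sigma^{\mathbb{A}}$ for every $\sigma\in\mathcal{S}^{<}_{\mathbb{A}}$, $\aleph_0\le|\sigma^{\mathbb{B}}|\le\kappa$ for all $\sigma\in\mathcal{S}^{\ge}_{\mathbb{A}}$, $|\sigma^{\mathbb{B}}|=\kappa$ for some $\sigma\in\mathcal{S}_\Sigma$, and $A_\sigma\subseteq\sigma^{\mathbb{B}}$ for all $\sigma\in\mathcal{S}_\Sigma$.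
   Context: Many-sorted first-order logic: a signature $\Sigma$ has a nonempty set $\mathcal{S}_\Sigma$ of sorts, a set $\mathcal{F}_\Sigma$ of function symbols and a set $\mathcal{P}_\Sigma$ of predicate symbols (including an equality symbol for each sort), with sorted arities; $|\Sigma|=|\mathcal{S}_\Sigma|+|\mathcal{F}_\Sigma|+|\mathcal{P}_\Sigma|$. A $\Sigma$-structure interprets each sort $\sigma$ as a nonempty set $\sigma^{\mathbb{A}}$. $\mathbb{A}$ is an elementary substructure of $\mathbb{B}$ if it is a substructure and for all formulas $\varphi$ and assignments $\nu$ into $\mathbb{A}$, $(\mathbb{A},\nu)\models\varphi$ iff $(\mathbb{B},\nu)\models\varphi$. For a structure $\mathbb{A}$, $\mathcal{S}^{\ge}_{\mathbb{A}}=\{\sigma\in\mathcal{S}_\Sigma:|\sigma^{\mathbb{A}}|\ge\aleph_0\}$ and $\mathcal{S}^{<}_{\mathbb{A}}=\mathcal{S}_\Sigma\setminus\mathcal{S}^{\ge}_{\mathbb{A}}$. *)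

theory Defs
  imports Main
begin

unbundle cardinal_syntax

text \<open>
  A function symbol \<open>f\<close> has arity \<open>fun_dom f \<rightarrow> fun_cod f\<close> (a constant if \<open>fun_dom f = []\<close>), and a
  predicate symbol \<open>p\<close> has arity \<open>pred_dom p\<close>.  The equality symbol \<open>eq_sym \<sigma>\<close> of a sort \<open>\<sigma>\<close>
  is itself a member of \<open>preds\<close>.  Symbols outside \<open>sorts\<close>, \<open>funs\<close> and \<open>preds\<close> are not part of the
  signature, and the record fields carry no information there.
\<close>

record ('s, 'f, 'p) signature =
  sorts :: "'s set"
  funs :: "'f set"
  preds :: "'p set"
  fun_dom :: "'f \<Rightarrow> 's list"
  fun_cod :: "'f \<Rightarrow> 's"
  pred_dom :: "'p \<Rightarrow> 's list"
  eq_sym :: "'s \<Rightarrow> 'p"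

definition is_signature :: "('s, 'f, 'p) signature \<Rightarrow> bool" where
  "is_signature \<Sigma> \<longleftrightarrow>
     sorts \<Sigma> \<noteq> {} \<and>
     (\<forall>f\<in>funs \<Sigma>. set (fun_dom \<Sigma> f) \<subseteq> sorts \<Sigma> \<and> fun_cod \<Sigma> f \<in> sorts \<Sigma>) \<and>
     (\<forall>p\<in>preds \<Sigma>. set (pred_dom \<Sigma> p) \<subseteq> sorts \<Sigma>) \<and>
     (\<forall>\<sigma>\<in>sorts \<Sigma>. eq_sym \<Sigma> \<sigma> \<in> preds \<Sigma> \<and> pred_dom \<Sigma> (eq_sym \<Sigma> \<sigma>) = [\<sigma>, \<sigma>])"

definition card_sig :: "('s, 'f, 'p) signature \<Rightarrow> (('s + 'f) + 'p) rel" where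
  "card_sig \<Sigma> = ( |sorts \<Sigma>| +c |funs \<Sigma>| ) +c |preds \<Sigma>|"

text \<open>
  A variable is a pair of an index and a sort, so that every sort has countably infinitely many
  variables of its own.
\<close>

datatype ('s, 'f) trm =
    Var nat 's
  | App 'f "('s, 'f) trm list"

datatype ('s, 'f, 'p) fm =
    Atom 'p "('s, 'f) trm list"
  | Neg "('s, 'f, 'p) fm"
  | Conj "('s, 'f, 'p) fm" "('s, 'f, 'p) fm"
  | Disj "('s, 'f, 'p) fm" "('s, 'f, 'p) fm"
  | Imp "('s, 'f, 'p) fm" "('s, 'f, 'p) fm"
  | Forall nat 's "('s, 'f, 'p) fm"
  | Exists nat 's "('s, 'f, 'p) fm"

inductive has_sort :: "('s, 'f, 'p) signature \<Rightarrow> ('s, 'f) trm \<Rightarrow> 's \<Rightarrow> bool"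
  for \<Sigma> :: "('s, 'f, 'p) signature" where
  Var: "\<sigma> \<in> sorts \<Sigma> \<Longrightarrow> has_sort \<Sigma> (Var n \<sigma>) \<sigma>"
| App: "f \<in> funs \<Sigma> \<Longrightarrow> list_all2 (has_sort \<Sigma>) ts (fun_dom \<Sigma> f) \<Longrightarrow>
        has_sort \<Sigma> (App f ts) (fun_cod \<Sigma> f)"

primrec is_formula :: "('s, 'f, 'p) signature \<Rightarrow> ('s, 'f, 'p) fm \<Rightarrow> bool" where
  "is_formula \<Sigma> (Atom p ts) \<longleftrightarrow> p \<in> preds \<Sigma> \<and> list_all2 (has_sort \<Sigma>) ts (pred_dom \<Sigma> p)"
| "is_formula \<Sigma> (Neg \<phi>) \<longleftrightarrow> is_formula \<Sigma> \<phi>"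
| "is_formula \<Sigma> (Conj \<phi> \<psi>) \<longleftrightarrow> is_formula \<Sigma> \<phi> \<and> is_formula \<Sigma> \<psi>"
| "is_formula \<Sigma> (Disj \<phi> \<psi>) \<longleftrightarrow> is_formula \<Sigma> \<phi> \<and> is_formula \<Sigma> \<psi>"
| "is_formula \<Sigma> (Imp \<phi> \<psi>) \<longleftrightarrow> is_formula \<Sigma> \<phi> \<and> is_formula \<Sigma> \<psi>"
| "is_formula \<Sigma> (Forall n \<sigma> \<phi>) \<longleftrightarrow> \<sigma> \<in> sorts \<Sigma> \<and> is_formula \<Sigma> \<phi>"
| "is_formula \<Sigma> (Exists n \<sigma> \<phi>) \<longleftrightarrow> \<sigma> \<in> sorts \<Sigma> \<and> is_formula \<Sigma> \<phi>"

text \<open>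
  The sort domains of a structure are arbitrary subsets of one type \<open>'a\<close>; they need not be disjoint.
  The value of \<open>fun_int\<close> on argument lists outside the product of the domains is irrelevant.
\<close>

record ('s, 'f, 'p, 'a) struct =
  sort_dom :: "'s \<Rightarrow> 'a set"
  fun_int :: "'f \<Rightarrow> 'a list \<Rightarrow> 'a"
  pred_int :: "'p \<Rightarrow> 'a list set"

definition prod_dom :: "('s, 'f, 'p, 'a) struct \<Rightarrow> 's list \<Rightarrow> 'a list set" where
  "prod_dom A \<sigma>s = listset (map (sort_dom A) \<sigma>s)"

definition is_struct :: "('s, 'f, 'p) signature \<Rightarrow> ('s, 'f, 'p, 'a) struct \<Rightarrow> bool" where
  "is_struct \<Sigma> A \<longleftrightarrow>
     (\<forall>\<sigma>\<in>sorts \<Sigma>. sort_dom A \<sigma> \<noteq> {}) \<and>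
     (\<forall>f\<in>funs \<Sigma>. \<forall>as\<in>prod_dom A (fun_dom \<Sigma> f). fun_int A f as \<in> sort_dom A (fun_cod \<Sigma> f)) \<and>
     (\<forall>p\<in>preds \<Sigma>. pred_int A p \<subseteq> prod_dom A (pred_dom \<Sigma> p)) \<and>
     (\<forall>\<sigma>\<in>sorts \<Sigma>. pred_int A (eq_sym \<Sigma> \<sigma>) = {[a, a] | a. a \<in> sort_dom A \<sigma>})"

type_synonym ('s, 'a) asg = "nat \<times> 's \<Rightarrow> 'a"

definition is_asg :: "('s, 'f, 'p) signature \<Rightarrow> ('s, 'f, 'p, 'a) struct \<Rightarrow> ('s, 'a) asg \<Rightarrow> bool"
  where "is_asg \<Sigma> A \<nu> \<longleftrightarrow> (\<forall>n. \<forall>\<sigma>\<in>sorts \<Sigma>. \<nu> (n, \<sigma>) \<in> sort_dom A \<sigma>)"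

primrec val :: "('s, 'f, 'p, 'a) struct \<Rightarrow> ('s, 'a) asg \<Rightarrow> ('s, 'f) trm \<Rightarrow> 'a" where
  "val A \<nu> (Var n \<sigma>) = \<nu> (n, \<sigma>)"
| "val A \<nu> (App f ts) = fun_int A f (map (val A \<nu>) ts)"

primrec sat :: "('s, 'f, 'p, 'a) struct \<Rightarrow> ('s, 'a) asg \<Rightarrow> ('s, 'f, 'p) fm \<Rightarrow> bool" where
  "sat A \<nu> (Atom p ts) \<longleftrightarrow> map (val A \<nu>) ts \<in> pred_int A p"
| "sat A \<nu> (Neg \<phi>) \<longleftrightarrow> \<not> sat A \<nu> \<phi>"
| "sat A \<nu> (Conj \<phi> \<psi>) \<longleftrightarrow> sat A \<nu> \<phi> \<and> sat A \<nu> \<psi>"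
| "sat A \<nu> (Disj \<phi> \<psi>) \<longleftrightarrow> sat A \<nu> \<phi> \<or> sat A \<nu> \<psi>"
| "sat A \<nu> (Imp \<phi> \<psi>) \<longleftrightarrow> (sat A \<nu> \<phi> \<longrightarrow> sat A \<nu> \<psi>)"
| "sat A \<nu> (Forall n \<sigma> \<phi>) \<longleftrightarrow> (\<forall>a\<in>sort_dom A \<sigma>. sat A (\<nu>((n, \<sigma>) := a)) \<phi>)"
| "sat A \<nu> (Exists n \<sigma> \<phi>) \<longleftrightarrow> (\<exists>a\<in>sort_dom A \<sigma>. sat A (\<nu>((n, \<sigma>) := a)) \<phi>)"

definition substructure ::
  "('s, 'f, 'p) signature \<Rightarrow> ('s, 'f, 'p, 'a) struct \<Rightarrow> ('s, 'f, 'p, 'a) struct \<Rightarrow> bool" where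
  "substructure \<Sigma> A B \<longleftrightarrow>
     is_struct \<Sigma> A \<and> is_struct \<Sigma> B \<and>
     (\<forall>\<sigma>\<in>sorts \<Sigma>. sort_dom A \<sigma> \<subseteq> sort_dom B \<sigma>) \<and>
     (\<forall>f\<in>funs \<Sigma>. \<forall>as\<in>prod_dom A (fun_dom \<Sigma> f). fun_int A f as = fun_int B f as) \<and>
     (\<forall>p\<in>preds \<Sigma>. pred_int A p = pred_int B p \<inter> prod_dom A (pred_dom \<Sigma> p))"

definition elementary_substructure ::
  "('s, 'f, 'p) signature \<Rightarrow> ('s, 'f, 'p, 'a) struct \<Rightarrow> ('s, 'f, 'p, 'a) struct \<Rightarrow> bool" where
  "elementary_substructure \<Sigma> A B \<longleftrightarrow>
     substructure \<Sigma> A B \<and>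
     (\<forall>\<phi> \<nu>. is_formula \<Sigma> \<phi> \<longrightarrow> is_asg \<Sigma> A \<nu> \<longrightarrow> (sat A \<nu> \<phi> \<longleftrightarrow> sat B \<nu> \<phi>))"

definition infinite_sorts :: "('s, 'f, 'p) signature \<Rightarrow> ('s, 'f, 'p, 'a) struct \<Rightarrow> 's set" where
  "infinite_sorts \<Sigma> A = {\<sigma> \<in> sorts \<Sigma>. natLeq \<le>o |sort_dom A \<sigma>| }"

definition finite_sorts :: "('s, 'f, 'p) signature \<Rightarrow> ('s, 'f, 'p, 'a) struct \<Rightarrow> 's set" where
  "finite_sorts \<Sigma> A = sorts \<Sigma> - infinite_sorts \<Sigma> A"

end

theory Submission
  imports Defs
begin

text \<open>
  Let \<open>Y \<sigma>\<close> be the whole domain when \<open>\<sigma>\<close> is finite, and \<open>X \<sigma>\<close> together with \<open>\<kappa>\<close> many elements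
  otherwise. The Skolem hull of \<open>Y\<close> is elementary by the Tarski-Vaught test. It is generated by at
  most \<open>\<kappa>\<close> many finitary operations, so it has at most \<open>\<kappa>\<close> elements, and each infinite sort gets
  exactly \<open>\<kappa>\<close>. The terms and the formulas are counted by the same principle, being generated by
  the symbols.
\<close>

section \<open>Cardinal bounds by an infinite set\<close>

lemma card_of_finite_ordLeq_infinite:
  assumes "finite A" and "infinite K"
  shows "|A| \<le>o |K|"
  using assms card_of_ordLeq_finite[of K A]
    ordLeq_total[OF card_of_Well_order[of A] card_of_Well_order[of K]] by blast

lemma card_of_Times_ordLeq_infinite:
  "infinite K \<Longrightarrow> |A| \<le>o |K| \<Longrightarrow> |B| \<le>o |K| \<Longrightarrow> |A \<times> B| \<le>o |K|"
  using card_of_Times_ordLeq_infinite_Field[of "|K|"] by (simp add: Field_card_of card_of_card_order_on)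

lemma card_of_Plus_ordLeq_infinite:
  "infinite K \<Longrightarrow> |A| \<le>o |K| \<Longrightarrow> |B| \<le>o |K| \<Longrightarrow> |A <+> B| \<le>o |K|"
  using card_of_Plus_ordLeq_infinite_Field[of "|K|"] by (simp add: Field_card_of card_of_card_order_on)

lemma card_of_Un_ordLeq_infinite:
  "infinite K \<Longrightarrow> |A| \<le>o |K| \<Longrightarrow> |B| \<le>o |K| \<Longrightarrow> |A \<union> B| \<le>o |K|"
  using card_of_Un_ordLeq_infinite_Field[of "|K|"] by (simp add: Field_card_of card_of_card_order_on)

text \<open>A product of two sets of size at most \<open>|K|\<close> is again that small, which
  bounds the lists of each fixed length by induction; there are only countably many lengths.\<close>

lemma card_of_lists_ordLeq_infinite:
  assumes K: "infinite K" and A: "|A| \<le>o |K|"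
  shows "|lists A| \<le>o |K|"
proof -
  let ?L = "\<lambda>n. {xs. set xs \<subseteq> A \<and> length xs = n}"
  have "|?L n| \<le>o |K|" for n
  proof (induction n)
    case 0
    have "finite (?L 0)" by simp
    then show ?case using K by (rule card_of_finite_ordLeq_infinite)
  next
    case (Suc n)
    have "?L (Suc n) \<subseteq> (\<lambda>(x, xs). x # xs) ` (A \<times> ?L n)"
    proof
      fix xs assume "xs \<in> ?L (Suc n)"
      then show "xs \<in> (\<lambda>(x, xs). x # xs) ` (A \<times> ?L n)" by (cases xs) auto
    qed
    then have "|?L (Suc n)| \<le>o |A \<times> ?L n|"
      using surj_imp_ordLeq by blast
    also have "|A \<times> ?L n| \<le>o |K|"
      using card_of_Times_ordLeq_infinite[OF K A] Suc by blast
    finally show ?case .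
  qed
  moreover have "|UNIV :: nat set| \<le>o |K|"
    using K infinite_iff_card_of_nat by blast
  ultimately have "|\<Union>n. ?L n| \<le>o |K|"
    by (intro card_of_UNION_ordLeq_infinite[OF K] ballI)
  moreover have "(\<Union>n. ?L n) = lists A" by (auto simp: in_lists_conv_set)
  ultimately show ?thesis by simp
qed

section \<open>Closure under finitary operations\<close>

text \<open>No base case is needed: the first elements arise from the empty argument list.
  Operations carry no arity and act on lists of every length, so \<open>G\<close> has to be total;
  its values on unintended lists do not affect the size bound.\<close>

inductive_set generated :: "'l set \<Rightarrow> ('l \<Rightarrow> 'x list \<Rightarrow> 'x) \<Rightarrow> 'x set"
  for L :: "'l set" and G :: "'l \<Rightarrow> 'x list \<Rightarrow> 'x" where
  generated_step: "l \<in> L \<Longrightarrow> xs \<in> lists (generated L G) \<Longrightarrow> G l xs \<in> generated L G"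

text \<open>Countably many stages exhaust the generated set. A stage applies all operations to the
  lists over the previous stage, so the bound \<open>|K|\<close> passes from each stage to the
  next.\<close>

lemma card_of_generated:
  fixes L :: "'l set" and G :: "'l \<Rightarrow> 'x list \<Rightarrow> 'x"
  assumes K: "infinite K" and L: "|L| \<le>o |K|"
  shows "|generated L G| \<le>o |K|"
proof -
  define F where "F S = case_prod G ` (L \<times> lists S)" for S
  define S where "S n = (F ^^ n) {}" for n
  have S_Suc: "S (Suc n) = F (S n)" for n by (simp add: S_def)
  have F_mono: "F U \<subseteq> F V" if "U \<subseteq> V" for U V
    using lists_mono[OF that] by (auto simp: F_def)
  have step: "S n \<subseteq> S (Suc n)" for n
    by (induction n) (auto simp: S_Suc F_mono, simp add: S_def)
  have mono: "S m \<subseteq> S n" if "m \<le> n" for m n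
    using lift_Suc_mono_le[of S, OF step that] .
  have "|S n| \<le>o |K|" for n
  proof (induction n)
    case 0
    show ?case by (simp add: S_def card_of_empty)
  next
    case (Suc n)
    have "|S (Suc n)| \<le>o |L \<times> lists (S n)|"
      unfolding S_Suc F_def by (rule card_of_image)
    also have "|L \<times> lists (S n)| \<le>o |K|"
      using card_of_Times_ordLeq_infinite[OF K L] card_of_lists_ordLeq_infinite[OF K Suc] by blast
    finally show ?case .
  qed
  moreover have "|UNIV :: nat set| \<le>o |K|"
    using K infinite_iff_card_of_nat by blast
  ultimately have bound: "|\<Union>n. S n| \<le>o |K|"
    by (intro card_of_UNION_ordLeq_infinite[OF K] ballI)
  \<comment> \<open>This is where finitary operations matter: the entries of a list lie in finitely
    many stages, and the stages increase, so one of them contains all entries.\<close>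
  have list: "\<exists>n. xs \<in> lists (S n)" if "xs \<in> lists (\<Union>n. S n)" for xs
    using that
  proof (induction xs)
    case (Cons x xs)
    then obtain m n where "x \<in> S m" "xs \<in> lists (S n)" by auto
    then have "x # xs \<in> lists (S (max m n))"
      using mono[of m "max m n"] lists_mono[OF mono[of n "max m n"]] by auto
    then show ?case by blast
  qed simp
  have "generated L G \<subseteq> (\<Union>n. S n)"
  proof
    fix x assume "x \<in> generated L G"
    then show "x \<in> (\<Union>n. S n)"
    proof induction
      case (generated_step l xs)
      then have "xs \<in> lists (\<Union>n. S n)" by auto
      then obtain n where "xs \<in> lists (S n)" using list by blast
      then have "G l xs \<in> S (Suc n)"
        using generated_step by (force simp: S_Suc F_def)
      then show ?case by blast
    qed
  qed
  then show ?thesis using bound card_of_mono1 ordLeq_transitive by blast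
qed

section \<open>Counting terms and formulas\<close>

text \<open>Labels are head symbols. Each variable is a label that ignores its arguments, which
  makes it a starting element of the closure.\<close>

primrec build_trm :: "(nat \<times> 's) + 'f \<Rightarrow> ('s, 'f) trm list \<Rightarrow> ('s, 'f) trm" where
  "build_trm (Inl v) ts = Var (fst v) (snd v)"
| "build_trm (Inr f) ts = App f ts"

lemma card_of_terms:
  fixes \<Sigma> :: "('s, 'f, 'p) signature"
  assumes K: "infinite K" and sorts: "|sorts \<Sigma>| \<le>o |K|" and funs: "|funs \<Sigma>| \<le>o |K|"
  shows "|{t. \<exists>\<sigma>. has_sort \<Sigma> t \<sigma>}| \<le>o |K|"
proof -
  let ?L = "((UNIV :: nat set) \<times> sorts \<Sigma>) <+> funs \<Sigma>"
  have nat: "|UNIV :: nat set| \<le>o |K|"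
    using K infinite_iff_card_of_nat by blast
  have "|(UNIV :: nat set) \<times> sorts \<Sigma>| \<le>o |K|"
    using card_of_Times_ordLeq_infinite[OF K nat] sorts by blast
  then have "|?L| \<le>o |K|"
    by (rule card_of_Plus_ordLeq_infinite[OF K _ funs])
  then have bound: "|generated ?L build_trm| \<le>o |K|" using card_of_generated[OF K] by blast
  \<comment> \<open>One inclusion suffices: the closure also holds ill-sorted terms, but it is small
    enough.\<close>
  have "t \<in> generated ?L build_trm" if "has_sort \<Sigma> t \<sigma>" for t \<sigma>
    using that
  proof induction
    case (Var \<sigma> n)
    then show ?case using generated_step[of "Inl (n, \<sigma>)" ?L "[]" build_trm] by auto
  next
    case (App f ts)
    then have "ts \<in> lists (generated ?L build_trm)"
      by (auto simp: in_lists_conv_set list_all2_conv_all_nth in_set_conv_nth)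
    then show ?case using generated_step[of "Inr f" ?L ts build_trm] App by auto
  qed
  then have "{t. \<exists>\<sigma>. has_sort \<Sigma> t \<sigma>} \<subseteq> generated ?L build_trm" by blast
  then show ?thesis using bound by (rule ordLeq_transitive[OF card_of_mono1])
qed

text \<open>An atom keeps its terms inside the label, because the operations of
  \<open>generated\<close> act on a single type, here that of formulas.\<close>

datatype ('s, 'f, 'p) fm_label =
    LAtom 'p "('s, 'f) trm list"
  | LNeg
  | LConj
  | LDisj
  | LImp
  | LForall nat 's
  | LExists nat 's

text \<open>On lists too short for \<open>!\<close> the result is unspecified, which is harmless
  because the closure serves only as an upper bound.\<close>

primrec build_fm :: "('s, 'f, 'p) fm_label \<Rightarrow> ('s, 'f, 'p) fm list \<Rightarrow> ('s, 'f, 'p) fm" where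
  "build_fm (LAtom p ts) \<phi>s = Atom p ts"
| "build_fm LNeg \<phi>s = Neg (\<phi>s ! 0)"
| "build_fm LConj \<phi>s = Conj (\<phi>s ! 0) (\<phi>s ! 1)"
| "build_fm LDisj \<phi>s = Disj (\<phi>s ! 0) (\<phi>s ! 1)"
| "build_fm LImp \<phi>s = Imp (\<phi>s ! 0) (\<phi>s ! 1)"
| "build_fm (LForall n \<sigma>) \<phi>s = Forall n \<sigma> (\<phi>s ! 0)"
| "build_fm (LExists n \<sigma>) \<phi>s = Exists n \<sigma> (\<phi>s ! 0)"

text \<open>The atoms number at most \<open>|K|\<close> because the terms, and hence the lists of
  terms, do; four connectives and the quantifiers over at most \<open>|K|\<close> variables generate
  the rest.\<close>

lemma card_of_formulas:
  fixes \<Sigma> :: "('s, 'f, 'p) signature"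
  assumes K: "infinite K" and sorts: "|sorts \<Sigma>| \<le>o |K|" and funs: "|funs \<Sigma>| \<le>o |K|"
    and preds: "|preds \<Sigma>| \<le>o |K|"
  shows "|{\<phi>. is_formula \<Sigma> \<phi>}| \<le>o |K|"
proof -
  let ?T = "{t. \<exists>\<sigma>. has_sort \<Sigma> t \<sigma>}"
  let ?At = "case_prod LAtom ` (preds \<Sigma> \<times> lists ?T) :: ('s, 'f, 'p) fm_label set"
  let ?Co = "{LNeg, LConj, LDisj, LImp} :: ('s, 'f, 'p) fm_label set"
  let ?Fo = "case_prod LForall ` (UNIV \<times> sorts \<Sigma>) :: ('s, 'f, 'p) fm_label set"
  let ?Ex = "case_prod LExists ` (UNIV \<times> sorts \<Sigma>) :: ('s, 'f, 'p) fm_label set"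
  let ?L = "(?At \<union> ?Co) \<union> (?Fo \<union> ?Ex)"
  have nat: "|UNIV :: nat set| \<le>o |K|"
    using K infinite_iff_card_of_nat by blast
  have image: "|f ` U| \<le>o |K|" if "|U| \<le>o |K|" for f :: "'u \<Rightarrow> ('s, 'f, 'p) fm_label" and U
    using card_of_image that by (rule ordLeq_transitive)
  have vars: "|(UNIV :: nat set) \<times> sorts \<Sigma>| \<le>o |K|"
    using card_of_Times_ordLeq_infinite[OF K nat] sorts by blast
  have "|preds \<Sigma> \<times> lists ?T| \<le>o |K|"
    using card_of_Times_ordLeq_infinite[OF K preds]
      card_of_lists_ordLeq_infinite[OF K card_of_terms[OF K sorts funs]] by blast
  then have "|?At| \<le>o |K|" "|?Fo| \<le>o |K|" "|?Ex| \<le>o |K|"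
    using image vars by blast+
  moreover have "|?Co| \<le>o |K|" using K by (intro card_of_finite_ordLeq_infinite) simp_all
  ultimately have "|?L| \<le>o |K|"
    using K card_of_Un_ordLeq_infinite by blast
  then have bound: "|generated ?L build_fm| \<le>o |K|" using card_of_generated[OF K] by blast
  have "\<phi> \<in> generated ?L build_fm" if "is_formula \<Sigma> \<phi>" for \<phi>
    using that
  proof (induction \<phi>)
    case (Atom p ts)
    then have "LAtom p ts \<in> ?At"
      by (force simp: in_lists_conv_set list_all2_conv_all_nth in_set_conv_nth)
    then show ?case using generated_step[of "LAtom p ts" ?L "[]" build_fm] by simp
  next
    case (Neg \<phi>)
    then show ?case using generated_step[of LNeg ?L "[\<phi>]" build_fm] by auto
  next
    case (Conj \<phi> \<psi>)
    then show ?case using generated_step[of LConj ?L "[\<phi>, \<psi>]" build_fm] by auto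
  next
    case (Disj \<phi> \<psi>)
    then show ?case using generated_step[of LDisj ?L "[\<phi>, \<psi>]" build_fm] by auto
  next
    case (Imp \<phi> \<psi>)
    then show ?case using generated_step[of LImp ?L "[\<phi>, \<psi>]" build_fm] by auto
  next
    case (Forall n \<sigma> \<phi>)
    then show ?case using generated_step[of "LForall n \<sigma>" ?L "[\<phi>]" build_fm] by auto
  next
    case (Exists n \<sigma> \<phi>)
    then show ?case using generated_step[of "LExists n \<sigma>" ?L "[\<phi>]" build_fm] by auto
  qed
  then have "{\<phi>. is_formula \<Sigma> \<phi>} \<subseteq> generated ?L build_fm" by blast
  then show ?thesis using bound by (rule ordLeq_transitive[OF card_of_mono1])
qed

section \<open>Assignments and finite support\<close>

lemma in_prod_dom_iff:
  "as \<in> prod_dom A \<sigma>s \<longleftrightarrow> list_all2 (\<lambda>a \<sigma>. a \<in> sort_dom A \<sigma>) as \<sigma>s"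
  unfolding prod_dom_def
  by (induction \<sigma>s arbitrary: as) (auto simp: set_Cons_def list_all2_Cons2)

text \<open>Finite support lets a Skolem function take a finite argument list. The functions
  \<open>\<nu>\<close> range over the whole type and not only over assignments into a structure, so
  junk values off \<open>V\<close> are allowed; \<open>V \<subseteq> U\<close> will restrict the
  arguments to variables of the signature.\<close>

definition finitely_supported :: "'v set \<Rightarrow> (('v \<Rightarrow> 'a) \<Rightarrow> 'b) \<Rightarrow> bool" where
  "finitely_supported U F \<longleftrightarrow>
     (\<exists>V. finite V \<and> V \<subseteq> U \<and> (\<forall>\<nu> \<nu>'. (\<forall>v\<in>V. \<nu> v = \<nu>' v) \<longrightarrow> F \<nu> = F \<nu>'))"

lemma finitely_supportedI:
  assumes "finite V" and "V \<subseteq> U" and "\<And>\<nu> \<nu>'. (\<And>v. v \<in> V \<Longrightarrow> \<nu> v = \<nu>' v) \<Longrightarrow> F \<nu> = F \<nu>'"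
  shows "finitely_supported U F"
  unfolding finitely_supported_def by (intro exI[of _ V] conjI allI impI assms) blast

lemma finitely_supported_comp2:
  fixes F :: "('v \<Rightarrow> 'a) \<Rightarrow> 'b" and G :: "('v \<Rightarrow> 'a) \<Rightarrow> 'c"
  assumes "finitely_supported U F" and "finitely_supported U G"
  shows "finitely_supported U (\<lambda>\<nu>. h (F \<nu>) (G \<nu>))"
proof -
  obtain V where V: "finite V" "V \<subseteq> U" "\<forall>\<nu> \<nu>'. (\<forall>v\<in>V. \<nu> v = \<nu>' v) \<longrightarrow> F \<nu> = F \<nu>'"
    using assms(1) unfolding finitely_supported_def by (elim exE conjE)
  obtain W where W: "finite W" "W \<subseteq> U" "\<forall>\<nu> \<nu>'. (\<forall>v\<in>W. \<nu> v = \<nu>' v) \<longrightarrow> G \<nu> = G \<nu>'"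
    using assms(2) unfolding finitely_supported_def by (elim exE conjE)
  show ?thesis
  proof (rule finitely_supportedI[of "V \<union> W"])
    fix \<nu> \<nu>' :: "'v \<Rightarrow> 'a" assume "\<And>v. v \<in> V \<union> W \<Longrightarrow> \<nu> v = \<nu>' v"
    then show "h (F \<nu>) (G \<nu>) = h (F \<nu>') (G \<nu>')" using V(3)[rule_format, of \<nu> \<nu>'] W(3)[rule_format, of \<nu> \<nu>'] by simp
  qed (use V W in auto)
qed

lemma finitely_supported_comp:
  "finitely_supported U F \<Longrightarrow> finitely_supported U (\<lambda>\<nu>. h (F \<nu>))"
  using finitely_supported_comp2[of U F F "\<lambda>x _. h x"] by simp

lemma finitely_supported_map:
  assumes "\<And>x. x \<in> set xs \<Longrightarrow> finitely_supported U (\<lambda>\<nu>. F \<nu> x)"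
  shows "finitely_supported U (\<lambda>\<nu>. map (F \<nu>) xs)"
  using assms
proof (induction xs)
  case Nil
  then show ?case by (simp add: finitely_supportedI[of "{}"])
next
  case (Cons x xs)
  then show ?case
    using finitely_supported_comp2[of U "\<lambda>\<nu>. F \<nu> x" "\<lambda>\<nu>. map (F \<nu>) xs" "(#)"] by simp
qed

text \<open>The result is taken as a function of \<open>a\<close>, so that one support works for all
  \<open>a\<close> at once; composition with \<open>Ball\<close> or \<open>Bex\<close> then yields a
  quantifier.\<close>

lemma finitely_supported_upd:
  assumes "finitely_supported U F"
  shows "finitely_supported U (\<lambda>\<nu> a. F (\<nu>(v := a)))"
proof -
  obtain V where V: "finite V" "V \<subseteq> U" "\<forall>\<nu> \<nu>'. (\<forall>v\<in>V. \<nu> v = \<nu>' v) \<longrightarrow> F \<nu> = F \<nu>'"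
    using assms unfolding finitely_supported_def by (elim exE conjE)
  show ?thesis
    by (rule finitely_supportedI[OF V(1,2)]) (intro ext V(3)[rule_format], simp)
qed

lemma finitely_supported_val:
  "has_sort \<Sigma> t \<sigma> \<Longrightarrow> finitely_supported (UNIV \<times> sorts \<Sigma>) (\<lambda>\<nu>. val A \<nu> t)"
proof (induction rule: has_sort.induct)
  case (Var \<sigma> n)
  then show ?case by (intro finitely_supportedI[of "{(n, \<sigma>)}"]) auto
next
  case (App f ts)
  then have "finitely_supported (UNIV \<times> sorts \<Sigma>) (\<lambda>\<nu>. map (val A \<nu>) ts)"
    by (intro finitely_supported_map) (auto simp: list_all2_conv_all_nth in_set_conv_nth)
  from finitely_supported_comp[OF this, of "fun_int A f"] show ?case by simp
qed

text \<open>Induction on the formula takes the place of computing free variables. The support found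
  may contain bound variables; only its finiteness and its sorts matter.\<close>

lemma finitely_supported_sat:
  "is_formula \<Sigma> \<phi> \<Longrightarrow> finitely_supported (UNIV \<times> sorts \<Sigma>) (\<lambda>\<nu>. sat A \<nu> \<phi>)"
proof (induction \<phi>)
  case (Atom p ts)
  have "finitely_supported (UNIV \<times> sorts \<Sigma>) (\<lambda>\<nu>. val A \<nu> t)" if "t \<in> set ts" for t
    using that Atom finitely_supported_val
    by (metis is_formula.simps(1) in_set_conv_nth list_all2_conv_all_nth)
  then have "finitely_supported (UNIV \<times> sorts \<Sigma>) (\<lambda>\<nu>. map (val A \<nu>) ts)"
    by (rule finitely_supported_map)
  from finitely_supported_comp[OF this, of "\<lambda>as. as \<in> pred_int A p"] show ?case by simp
next
  case (Forall n \<sigma> \<phi>)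
  then show ?case
    using finitely_supported_comp[OF finitely_supported_upd, of _ "\<lambda>\<nu>. sat A \<nu> \<phi>" "Ball (sort_dom A \<sigma>)"]
    by simp
next
  case (Exists n \<sigma> \<phi>)
  then show ?case
    using finitely_supported_comp[OF finitely_supported_upd, of _ "\<lambda>\<nu>. sat A \<nu> \<phi>" "Bex (sort_dom A \<sigma>)"]
    by simp
qed (simp_all add: finitely_supported_comp[of _ _ Not] finitely_supported_comp2[of _ _ _ "(\<and>)"]
  finitely_supported_comp2[of _ _ _ "(\<or>)"] finitely_supported_comp2[of _ _ _ "(\<longrightarrow>)"])

section \<open>Substructures and the Tarski-Vaught test\<close>

text \<open>Both claims go through one induction: the two interpretations of a function symbol agree
  only on arguments from \<open>B\<close>, so the values of the subterms must be known to lie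
  there.\<close>

lemma substructure_val:
  assumes sub: "substructure \<Sigma> B A" and \<nu>: "is_asg \<Sigma> B \<nu>" and "has_sort \<Sigma> t \<sigma>"
  shows "val B \<nu> t = val A \<nu> t \<and> val B \<nu> t \<in> sort_dom B \<sigma>"
  using assms(3)
proof induction
  case (Var \<sigma> n)
  then show ?case using \<nu> by (auto simp: is_asg_def)
next
  case (App f ts)
  have eq: "map (val B \<nu>) ts = map (val A \<nu>) ts"
    using App(2) by (auto simp: list_all2_conv_all_nth in_set_conv_nth)
  have "map (val B \<nu>) ts \<in> prod_dom B (fun_dom \<Sigma> f)"
    using App(2) by (auto simp: in_prod_dom_iff list_all2_conv_all_nth)
  then show ?case using sub App(1) eq
    by (auto simp: substructure_def is_struct_def simp del: map_eq_conv)
qed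

text \<open>At a quantifier the induction hypothesis turns satisfaction in \<open>B\<close> into
  satisfaction in \<open>A\<close>, with the range still \<open>B\<close>; \<open>witness\<close>
  then extends the range to \<open>A\<close>. Since \<open>witness\<close> mentions satisfaction in
  \<open>A\<close> only, it can be checked before anything is known about truth in
  \<open>B\<close>.\<close>

lemma tarski_vaught:
  assumes sub: "substructure \<Sigma> B A"
    and witness: "\<And>n \<sigma> \<phi> \<nu>. is_formula \<Sigma> \<phi> \<Longrightarrow> \<sigma> \<in> sorts \<Sigma> \<Longrightarrow> is_asg \<Sigma> B \<nu> \<Longrightarrow>
      \<exists>a\<in>sort_dom A \<sigma>. sat A (\<nu>((n, \<sigma>) := a)) \<phi> \<Longrightarrow>
      \<exists>b\<in>sort_dom B \<sigma>. sat A (\<nu>((n, \<sigma>) := b)) \<phi>"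
  shows "elementary_substructure \<Sigma> B A"
proof -
  have dom: "sort_dom B \<sigma> \<subseteq> sort_dom A \<sigma>" if "\<sigma> \<in> sorts \<Sigma>" for \<sigma>
    using sub that by (auto simp: substructure_def)
  have upd: "is_asg \<Sigma> B (\<nu>((n, \<sigma>) := b))" if "is_asg \<Sigma> B \<nu>" "b \<in> sort_dom B \<sigma>" for \<nu> n \<sigma> b
    using that by (auto simp: is_asg_def)
  have "sat B \<nu> \<phi> = sat A \<nu> \<phi>" if "is_formula \<Sigma> \<phi>" "is_asg \<Sigma> B \<nu>" for \<phi> \<nu>
    using that
  proof (induction \<phi> arbitrary: \<nu>)
    case (Atom p ts)
    have val: "val B \<nu> (ts ! i) = val A \<nu> (ts ! i) \<and> val B \<nu> (ts ! i) \<in> sort_dom B (pred_dom \<Sigma> p ! i)"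
      if "i < length ts" for i
      using that Atom substructure_val[OF sub] by (auto simp: list_all2_conv_all_nth)
    then have eq: "map (val B \<nu>) ts = map (val A \<nu>) ts"
      by (auto simp: in_set_conv_nth)
    have "map (val B \<nu>) ts \<in> prod_dom B (pred_dom \<Sigma> p)"
      using val Atom(1) unfolding in_prod_dom_iff list_all2_conv_all_nth
      by (metis is_formula.simps(1) length_map list_all2_lengthD nth_map)
    then show ?case using sub Atom(1) eq
      by (auto simp: substructure_def simp del: map_eq_conv)
  next
    case (Forall n \<sigma> \<phi>)
    then have "sat B \<nu> (Forall n \<sigma> \<phi>) \<longleftrightarrow> (\<forall>b\<in>sort_dom B \<sigma>. sat A (\<nu>((n, \<sigma>) := b)) \<phi>)"
      using upd by simp
    \<comment> \<open>A counterexample in \<open>A\<close> is a witness for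
      \<open>Neg \<phi>\<close>, so there is also one in \<open>B\<close>.\<close>
    also have "\<dots> \<longleftrightarrow> sat A \<nu> (Forall n \<sigma> \<phi>)"
      using witness[of "Neg \<phi>" \<sigma> \<nu> n] dom[of \<sigma>] Forall.prems by auto
    finally show ?case .
  next
    case (Exists n \<sigma> \<phi>)
    then have "sat B \<nu> (Exists n \<sigma> \<phi>) \<longleftrightarrow> (\<exists>b\<in>sort_dom B \<sigma>. sat A (\<nu>((n, \<sigma>) := b)) \<phi>)"
      using upd by simp
    also have "\<dots> \<longleftrightarrow> sat A \<nu> (Exists n \<sigma> \<phi>)"
      using witness[of \<phi> \<sigma> \<nu> n] dom[of \<sigma>] Exists.prems by auto
    finally show ?case .
  qed auto
  then show ?thesis using sub by (simp add: elementary_substructure_def)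
qed

section \<open>Skolem hulls\<close>

datatype ('s, 'f, 'p, 'a) hull_label =
    LBase 's 'a
  | LFun 'f
  | LSkolem "('s, 'f, 'p) fm" nat 's "(nat \<times> 's) list"

text \<open>
  A Skolem label carries the list of variables to which the argument list is assigned, so that
  finitely many arguments determine the relevant part of an assignment; the other variables get the
  junk value \<open>the None\<close>. The default values keep the hull inside the structure, so that no argument
  list has to be checked for its sorts.
\<close>

primrec hull_op ::
  "('s, 'f, 'p) signature \<Rightarrow> ('s, 'f, 'p, 'a) struct \<Rightarrow> ('s, 'f, 'p, 'a) hull_label \<Rightarrow>
    ('s \<times> 'a) list \<Rightarrow> 's \<times> 'a" where
  "hull_op \<Sigma> A (LBase \<sigma> a) xs = (\<sigma>, a)"
| "hull_op \<Sigma> A (LFun f) xs = (fun_cod \<Sigma> f,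
     if map snd xs \<in> prod_dom A (fun_dom \<Sigma> f) then fun_int A f (map snd xs)
     else (SOME a. a \<in> sort_dom A (fun_cod \<Sigma> f)))"
| "hull_op \<Sigma> A (LSkolem \<phi> n \<sigma> vs) xs = (\<sigma>,
     let \<nu> = (\<lambda>v. the (map_of (zip vs (map snd xs)) v));
         P = (\<lambda>a. a \<in> sort_dom A \<sigma> \<and> sat A (\<nu>((n, \<sigma>) := a)) \<phi>)
     in if \<exists>a. P a then (SOME a. P a) else (SOME a. a \<in> sort_dom A \<sigma>))"

text \<open>The types of symbols may be larger than the signature. Admitting only its formulas,
  sorts and function symbols keeps the labels few and makes every output carry a sort of the
  signature.\<close>

definition hull_labels ::
  "('s, 'f, 'p) signature \<Rightarrow> ('s \<Rightarrow> 'a set) \<Rightarrow> ('s, 'f, 'p, 'a) hull_label set" where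
  "hull_labels \<Sigma> Y =
     (case_prod LBase ` (SIGMA \<sigma>:sorts \<Sigma>. Y \<sigma>) \<union> LFun ` funs \<Sigma>) \<union>
     (\<lambda>(\<phi>, n, \<sigma>, vs). LSkolem \<phi> n \<sigma> vs) `
       ({\<phi>. is_formula \<Sigma> \<phi>} \<times> UNIV \<times> sorts \<Sigma> \<times> lists (UNIV \<times> sorts \<Sigma>))"

text \<open>Elements are generated together with a sort, because the domains may overlap and an
  element obtained in one sort need not belong to the hull in another.\<close>

definition skolem_hull ::
  "('s, 'f, 'p) signature \<Rightarrow> ('s, 'f, 'p, 'a) struct \<Rightarrow> ('s \<Rightarrow> 'a set) \<Rightarrow> 's \<Rightarrow> 'a set" where
  "skolem_hull \<Sigma> A Y \<sigma> = {a. (\<sigma>, a) \<in> generated (hull_labels \<Sigma> Y) (hull_op \<Sigma> A)}"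

lemma card_of_hull_labels:
  fixes \<Sigma> :: "('s, 'f, 'p) signature" and Y :: "'s \<Rightarrow> 'a set"
  assumes K: "infinite K" and sorts: "|sorts \<Sigma>| \<le>o |K|" and funs: "|funs \<Sigma>| \<le>o |K|"
    and preds: "|preds \<Sigma>| \<le>o |K|" and Y: "\<And>\<sigma>. \<sigma> \<in> sorts \<Sigma> \<Longrightarrow> |Y \<sigma>| \<le>o |K|"
  shows "|hull_labels \<Sigma> Y :: ('s, 'f, 'p, 'a) hull_label set| \<le>o |K|"
proof -
  have nat: "|UNIV :: nat set| \<le>o |K|"
    using K infinite_iff_card_of_nat by blast
  have "|(UNIV :: nat set) \<times> sorts \<Sigma>| \<le>o |K|"
    using nat sorts card_of_Times_ordLeq_infinite[OF K nat] by blast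
  from card_of_lists_ordLeq_infinite[OF K this]
  have "|sorts \<Sigma> \<times> lists ((UNIV :: nat set) \<times> sorts \<Sigma>)| \<le>o |K|"
    using card_of_Times_ordLeq_infinite[OF K sorts] by blast
  then have "|(UNIV :: nat set) \<times> sorts \<Sigma> \<times> lists ((UNIV :: nat set) \<times> sorts \<Sigma>)| \<le>o |K|"
    using card_of_Times_ordLeq_infinite[OF K nat] by blast
  then have "|{\<phi>. is_formula \<Sigma> \<phi>} \<times> (UNIV :: nat set) \<times> sorts \<Sigma> \<times> lists ((UNIV :: nat set) \<times> sorts \<Sigma>)| \<le>o |K|"
    using card_of_Times_ordLeq_infinite[OF K card_of_formulas[OF K sorts funs preds]] by blast
  moreover have "|SIGMA \<sigma>:sorts \<Sigma>. Y \<sigma>| \<le>o |K|"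
    using card_of_Sigma_ordLeq_infinite[OF K sorts] Y by blast
  ultimately show ?thesis
    unfolding hull_labels_def using funs
    by (intro card_of_Un_ordLeq_infinite[OF K] ordLeq_transitive[OF card_of_image])
qed

lemma card_of_skolem_hull:
  assumes "infinite K" and "|sorts \<Sigma>| \<le>o |K|" and "|funs \<Sigma>| \<le>o |K|"
    and "|preds \<Sigma>| \<le>o |K|" and "\<And>\<sigma>. \<sigma> \<in> sorts \<Sigma> \<Longrightarrow> |Y \<sigma>| \<le>o |K|"
  shows "|skolem_hull \<Sigma> A Y \<sigma>| \<le>o |K|"
proof -
  have "skolem_hull \<Sigma> A Y \<sigma> \<subseteq> snd ` generated (hull_labels \<Sigma> Y) (hull_op \<Sigma> A)"
    by (force simp: skolem_hull_def)
  then have "|skolem_hull \<Sigma> A Y \<sigma>| \<le>o |generated (hull_labels \<Sigma> Y) (hull_op \<Sigma> A)|"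
    by (rule surj_imp_ordLeq)
  also have "|generated (hull_labels \<Sigma> Y) (hull_op \<Sigma> A)| \<le>o |K|"
    using card_of_generated card_of_hull_labels assms by blast
  finally show ?thesis .
qed

lemma subset_skolem_hull:
  assumes "\<sigma> \<in> sorts \<Sigma>"
  shows "Y \<sigma> \<subseteq> skolem_hull \<Sigma> A Y \<sigma>"
proof
  fix a assume "a \<in> Y \<sigma>"
  then have "LBase \<sigma> a \<in> hull_labels \<Sigma> Y" using assms by (force simp: hull_labels_def)
  then show "a \<in> skolem_hull \<Sigma> A Y \<sigma>"
    using generated_step[of "LBase \<sigma> a" _ "[]" "hull_op \<Sigma> A"] by (simp add: skolem_hull_def)
qed

text \<open>Thanks to the default values, every output of \<open>hull_op\<close> lies in the domain
  of its sort, whatever the arguments. Inspecting the last operation is therefore enough, without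
  induction.\<close>

lemma skolem_hull_subset:
  fixes \<Sigma> :: "('s, 'f, 'p) signature"
  assumes \<Sigma>: "is_signature \<Sigma>" and A: "is_struct \<Sigma> A"
    and Y: "\<And>\<sigma>. \<sigma> \<in> sorts \<Sigma> \<Longrightarrow> Y \<sigma> \<subseteq> sort_dom A \<sigma>"
  shows "skolem_hull \<Sigma> A Y \<sigma> \<subseteq> sort_dom A \<sigma>"
proof -
  have ne: "(SOME a. a \<in> sort_dom A \<sigma>) \<in> sort_dom A \<sigma>" if "\<sigma> \<in> sorts \<Sigma>" for \<sigma>
    using A that by (simp add: is_struct_def some_in_eq)
  have op: "snd (hull_op \<Sigma> A l xs) \<in> sort_dom A (fst (hull_op \<Sigma> A l xs))"
    if "l \<in> hull_labels \<Sigma> Y" for l :: "('s, 'f, 'p, 'a) hull_label" and xs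
  proof (cases l)
    case (LBase \<tau> a)
    then show ?thesis using that Y by (auto simp: hull_labels_def)
  next
    case (LFun f)
    then have "f \<in> funs \<Sigma>" using that by (auto simp: hull_labels_def)
    then show ?thesis using LFun \<Sigma> A ne by (auto simp: is_signature_def is_struct_def)
  next
    case (LSkolem \<phi> n \<tau> vs)
    then have "\<tau> \<in> sorts \<Sigma>" using that by (auto simp: hull_labels_def)
    moreover have "(SOME a. a \<in> sort_dom A \<tau> \<and> Q a) \<in> sort_dom A \<tau>"
      if "\<exists>a. a \<in> sort_dom A \<tau> \<and> Q a" for Q
      using someI_ex[OF that] by blast
    ultimately show ?thesis using LSkolem ne by (simp add: Let_def)
  qed
  have "snd x \<in> sort_dom A (fst x)" if "x \<in> generated (hull_labels \<Sigma> Y) (hull_op \<Sigma> A)" for x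
    using that by cases (use op in blast)
  then show ?thesis by (force simp: skolem_hull_def)
qed

text \<open>The arguments, tagged with the sorts in \<open>fun_dom\<close>, form a list over the
  generated set. By \<open>dom\<close>, the operation \<open>LFun f\<close> returns the true value
  of \<open>f\<close> on them and not its default.\<close>

lemma skolem_hull_fun_closed:
  assumes f: "f \<in> funs \<Sigma>" and as: "list_all2 (\<lambda>a \<sigma>. a \<in> skolem_hull \<Sigma> A Y \<sigma>) as (fun_dom \<Sigma> f)"
    and dom: "as \<in> prod_dom A (fun_dom \<Sigma> f)"
  shows "fun_int A f as \<in> skolem_hull \<Sigma> A Y (fun_cod \<Sigma> f)"
proof -
  let ?xs = "zip (fun_dom \<Sigma> f) as"
  have "?xs \<in> lists (generated (hull_labels \<Sigma> Y) (hull_op \<Sigma> A))"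
    using as by (auto simp: in_lists_conv_set in_set_zip list_all2_conv_all_nth skolem_hull_def)
  moreover have "LFun f \<in> hull_labels \<Sigma> Y" using f by (simp add: hull_labels_def)
  moreover have "map snd ?xs = as" using as by (simp add: list_all2_lengthD)
  ultimately show ?thesis
    using generated_step[of "LFun f" "hull_labels \<Sigma> Y" ?xs "hull_op \<Sigma> A"] dom
    by (simp add: skolem_hull_def)
qed

text \<open>The witness is the Skolem function of \<open>\<phi>\<close> applied to the values of
  \<open>\<nu>\<close> on a finite support of \<open>\<phi>\<close>. These values lie in the hull,
  hence so does the witness.\<close>

lemma skolem_hull_witness:
  assumes \<phi>: "is_formula \<Sigma> \<phi>" and \<sigma>: "\<sigma> \<in> sorts \<Sigma>"
    and \<nu>: "\<And>m \<tau>. \<tau> \<in> sorts \<Sigma> \<Longrightarrow> \<nu> (m, \<tau>) \<in> skolem_hull \<Sigma> A Y \<tau>"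
    and ex: "\<exists>a\<in>sort_dom A \<sigma>. sat A (\<nu>((n, \<sigma>) := a)) \<phi>"
  shows "\<exists>b\<in>skolem_hull \<Sigma> A Y \<sigma>. sat A (\<nu>((n, \<sigma>) := b)) \<phi>"
proof -
  obtain V where "finite V" and V: "V \<subseteq> UNIV \<times> sorts \<Sigma>"
    and supp: "\<forall>\<nu> \<nu>'. (\<forall>v\<in>V. \<nu> v = \<nu>' v) \<longrightarrow> sat A \<nu> \<phi> = sat A \<nu>' \<phi>"
    using finitely_supported_sat[OF \<phi>, of A] unfolding finitely_supported_def by (elim exE conjE)
  obtain vs where vs: "set vs = V" using finite_list[OF \<open>finite V\<close>] by blast
  let ?xs = "map (\<lambda>v. (snd v, \<nu> v)) vs"
  \<comment> \<open>This is the assignment that \<open>hull_op\<close> rebuilds from its argument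
    list. It agrees with \<open>\<nu>\<close> on \<open>V\<close>, and repetitions in
    \<open>vs\<close> do no harm since they carry equal values.\<close>
  define \<nu>' where "\<nu>' v = the (map_of (zip vs (map snd ?xs)) v)" for v
  have "map_of (zip vs (map \<nu> vs)) v = Some (\<nu> v)" if "v \<in> V" for v
    using that vs by (simp add: map_of_zip_map)
  then have "\<forall>v\<in>V. \<nu>' v = \<nu> v" by (simp add: \<nu>'_def comp_def)
  \<comment> \<open>Updating both assignments at the same variable preserves agreement on
    \<open>V\<close>, whether or not \<open>(n, \<sigma>)\<close> belongs to
    \<open>V\<close>.\<close>
  then have eq: "sat A (\<nu>'((n, \<sigma>) := a)) \<phi> = sat A (\<nu>((n, \<sigma>) := a)) \<phi>" for a
    by (intro supp[rule_format]) simp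
  define P where "P a \<longleftrightarrow> a \<in> sort_dom A \<sigma> \<and> sat A (\<nu>'((n, \<sigma>) := a)) \<phi>" for a
  have "\<exists>a. P a" using ex eq by (auto simp: P_def)
  have op: "hull_op \<Sigma> A (LSkolem \<phi> n \<sigma> vs) ?xs = (\<sigma>, SOME a. P a)"
    using \<open>\<exists>a. P a\<close> by (simp add: Let_def \<nu>'_def[symmetric, abs_def] P_def[symmetric] del: map_map)
  have "?xs \<in> lists (generated (hull_labels \<Sigma> Y) (hull_op \<Sigma> A))"
    using V vs \<nu> by (auto simp: in_lists_conv_set skolem_hull_def)
  moreover have "LSkolem \<phi> n \<sigma> vs \<in> hull_labels \<Sigma> Y"
    unfolding hull_labels_def
    by (rule UnI2, rule image_eqI[of _ _ "(\<phi>, n, \<sigma>, vs)"])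
      (use \<phi> \<sigma> V vs in \<open>auto simp: in_lists_conv_set\<close>)
  ultimately have "(SOME a. P a) \<in> skolem_hull \<Sigma> A Y \<sigma>"
    using generated_step[of "LSkolem \<phi> n \<sigma> vs" "hull_labels \<Sigma> Y" ?xs "hull_op \<Sigma> A"] op
    by (simp add: skolem_hull_def)
  moreover have "sat A (\<nu>((n, \<sigma>) := SOME a. P a)) \<phi>"
    using someI_ex[OF \<open>\<exists>a. P a\<close>] eq by (simp add: P_def)
  ultimately show ?thesis by blast
qed

section \<open>Restriction of a structure to smaller domains\<close>

text \<open>Functions stay as they are, since their values off the domains are irrelevant;
  predicates must be cut down because \<open>is_struct\<close> demands that they lie within the
  product of the domains.\<close>

definition restrict_struct ::
  "('s, 'f, 'p) signature \<Rightarrow> ('s, 'f, 'p, 'a) struct \<Rightarrow> ('s \<Rightarrow> 'a set) \<Rightarrow> ('s, 'f, 'p, 'a) struct" where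
  "restrict_struct \<Sigma> A D = \<lparr>sort_dom = D, fun_int = fun_int A,
     pred_int = (\<lambda>p. pred_int A p \<inter> listset (map D (pred_dom \<Sigma> p)))\<rparr>"

lemma substructure_restrict_struct:
  assumes \<Sigma>: "is_signature \<Sigma>" and A: "is_struct \<Sigma> A"
    and D: "\<And>\<sigma>. \<sigma> \<in> sorts \<Sigma> \<Longrightarrow> D \<sigma> \<noteq> {} \<and> D \<sigma> \<subseteq> sort_dom A \<sigma>"
    and closed: "\<And>f as. f \<in> funs \<Sigma> \<Longrightarrow> list_all2 (\<lambda>a \<sigma>. a \<in> D \<sigma>) as (fun_dom \<Sigma> f) \<Longrightarrow>
      fun_int A f as \<in> D (fun_cod \<Sigma> f)"
  shows "substructure \<Sigma> (restrict_struct \<Sigma> A D) A"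
proof -
  let ?B = "restrict_struct \<Sigma> A D"
  \<comment> \<open>Equality stays equality: the diagonal of the old domain meets the pairs over
    \<open>D \<sigma>\<close> in the diagonal of \<open>D \<sigma>\<close>.\<close>
  have "pred_int ?B (eq_sym \<Sigma> \<sigma>) = {[a, a] |a. a \<in> D \<sigma>}" if "\<sigma> \<in> sorts \<Sigma>" for \<sigma>
    using that \<Sigma> A D[OF that]
    by (auto simp: is_signature_def is_struct_def restrict_struct_def set_Cons_def)
  moreover have "as \<in> prod_dom ?B \<sigma>s \<longleftrightarrow> list_all2 (\<lambda>a \<sigma>. a \<in> D \<sigma>) as \<sigma>s" for as \<sigma>s
    by (simp add: in_prod_dom_iff restrict_struct_def)
  moreover have "pred_int ?B p \<subseteq> prod_dom ?B (pred_dom \<Sigma> p)" for p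
    by (simp add: restrict_struct_def prod_dom_def)
  ultimately have "is_struct \<Sigma> ?B"
    using D closed unfolding is_struct_def by (simp add: restrict_struct_def)
  then show ?thesis
    using A D by (auto simp: substructure_def) (auto simp: restrict_struct_def prod_dom_def)
qed

text \<open>Function labels make the hull a substructure, and Skolem labels supply the witnesses for
  the Tarski-Vaught test.\<close>

lemma skolem_hull_elementary:
  assumes \<Sigma>: "is_signature \<Sigma>" and A: "is_struct \<Sigma> A"
    and Y: "\<And>\<sigma>. \<sigma> \<in> sorts \<Sigma> \<Longrightarrow> Y \<sigma> \<noteq> {} \<and> Y \<sigma> \<subseteq> sort_dom A \<sigma>"
  shows "elementary_substructure \<Sigma> (restrict_struct \<Sigma> A (skolem_hull \<Sigma> A Y)) A"
proof (rule tarski_vaught)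
  let ?D = "skolem_hull \<Sigma> A Y"
  have sub: "?D \<sigma> \<subseteq> sort_dom A \<sigma>" for \<sigma>
    using skolem_hull_subset[OF \<Sigma> A, of Y] Y by blast
  have ne: "?D \<sigma> \<noteq> {}" if "\<sigma> \<in> sorts \<Sigma>" for \<sigma>
    using Y[OF that] subset_skolem_hull[OF that, of Y A] by blast
  show "substructure \<Sigma> (restrict_struct \<Sigma> A ?D) A"
  proof (rule substructure_restrict_struct[OF \<Sigma> A])
    fix f as assume "f \<in> funs \<Sigma>" and as: "list_all2 (\<lambda>a \<sigma>. a \<in> ?D \<sigma>) as (fun_dom \<Sigma> f)"
    moreover have "as \<in> prod_dom A (fun_dom \<Sigma> f)"
      unfolding in_prod_dom_iff using as by (rule list_all2_mono) (use sub in blast)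
    ultimately show "fun_int A f as \<in> ?D (fun_cod \<Sigma> f)" by (rule skolem_hull_fun_closed)
  qed (use sub ne in blast)
  fix n \<sigma> \<phi> \<nu>
  assume "is_formula \<Sigma> \<phi>" "\<sigma> \<in> sorts \<Sigma>" and \<nu>: "is_asg \<Sigma> (restrict_struct \<Sigma> A ?D) \<nu>"
    and "\<exists>a\<in>sort_dom A \<sigma>. sat A (\<nu>((n, \<sigma>) := a)) \<phi>"
  then show "\<exists>b\<in>sort_dom (restrict_struct \<Sigma> A ?D) \<sigma>. sat A (\<nu>((n, \<sigma>) := b)) \<phi>"
    using skolem_hull_witness[of \<Sigma> \<phi> \<sigma> \<nu> A Y n] by (simp add: is_asg_def restrict_struct_def)
qed

section \<open>Elementary substructures of prescribed size\<close>

theorem theorem4: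
  fixes \<Sigma> :: "('s, 'f, 'p) signature"
    and A :: "('s, 'f, 'p, 'a) struct"
    and \<kappa> :: "'k rel"
    and X :: "'s \<Rightarrow> 'a set"
  assumes "is_signature \<Sigma>"
    and "finite (sorts \<Sigma>)"
    and "is_struct \<Sigma> A"
    and "\<exists>\<sigma>\<in>sorts \<Sigma>. natLeq \<le>o |sort_dom A \<sigma>|"
    and "Card_order \<kappa>"
    and "card_sig \<Sigma> \<le>o \<kappa>"
    and "natLeq \<le>o \<kappa>"
    and "\<forall>\<sigma>\<in>infinite_sorts \<Sigma> A. \<kappa> \<le>o |sort_dom A \<sigma>|"
    and "\<forall>\<sigma>\<in>sorts \<Sigma>. X \<sigma> \<subseteq> sort_dom A \<sigma> \<and> |X \<sigma>| \<le>o \<kappa>"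
  shows "\<exists>B :: ('s, 'f, 'p, 'a) struct.
           elementary_substructure \<Sigma> B A \<and>
           (\<forall>\<sigma>\<in>finite_sorts \<Sigma> A. sort_dom B \<sigma> = sort_dom A \<sigma>) \<and>
           (\<forall>\<sigma>\<in>infinite_sorts \<Sigma> A. natLeq \<le>o |sort_dom B \<sigma>| \<and> |sort_dom B \<sigma>| \<le>o \<kappa>) \<and>
           (\<exists>\<sigma>\<in>sorts \<Sigma>. |sort_dom B \<sigma>| =o \<kappa>) \<and>
           (\<forall>\<sigma>\<in>sorts \<Sigma>. X \<sigma> \<subseteq> sort_dom B \<sigma>)"
proof -
  \<comment> \<open>The relation \<open>\<kappa>\<close> is an arbitrary cardinal order; its field
    is a set of that size, to which the bounds in terms of \<open>|K|\<close> apply.\<close>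
  let ?K = "Field \<kappa>"
  have \<kappa>: "|?K| =o \<kappa>" using assms(5) by (rule card_of_Field_ordIso)
  then have \<kappa>': "\<kappa> =o |?K|" by (rule ordIso_symmetric)
  have K: "infinite ?K"
    using assms(5,7) by (metis Card_order_iff_ordLeq_card_of cinfinite_def cinfinite_mono natLeq_cinfinite)
  have le: "r \<le>o |?K|" if "r \<le>o \<kappa>" for r :: "'x rel"
    using ordLeq_ordIso_trans[OF that \<kappa>'] .
  have "|sorts \<Sigma> <+> funs \<Sigma>| \<le>o card_sig \<Sigma>" "|preds \<Sigma>| \<le>o card_sig \<Sigma>"
    unfolding card_sig_def csum_def Field_card_of by (rule card_of_Plus1 card_of_Plus2)+
  then have SF: "|sorts \<Sigma> <+> funs \<Sigma>| \<le>o |?K|" and preds: "|preds \<Sigma>| \<le>o |?K|"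
    using ordLeq_transitive[OF _ assms(6)] ordLeq_ordIso_trans[OF _ \<kappa>'] by blast+
  have sorts: "|sorts \<Sigma>| \<le>o |?K|" and funs: "|funs \<Sigma>| \<le>o |?K|"
    using SF card_of_Plus1 card_of_Plus2 ordLeq_transitive by blast+
  \<comment> \<open>The upper bound on \<open>\<kappa>\<close> enters here: each infinite domain
    contains an injective image of \<open>?K\<close>.\<close>
  have "\<exists>U. U \<subseteq> sort_dom A \<sigma> \<and> |U| =o |?K|" if "\<sigma> \<in> infinite_sorts \<Sigma> A" for \<sigma>
  proof -
    have "|?K| \<le>o |sort_dom A \<sigma>|"
      using assms(8) that ordIso_ordLeq_trans[OF \<kappa>] by blast
    then obtain f where "inj_on f ?K" "f ` ?K \<subseteq> sort_dom A \<sigma>"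
      using card_of_ordLeq[of ?K "sort_dom A \<sigma>"] by blast
    moreover from this have "|f ` ?K| =o |?K|"
      by (meson card_of_ordIso inj_on_imp_bij_betw ordIso_symmetric)
    ultimately show ?thesis by blast
  qed
  then obtain U where U: "\<And>\<sigma>. \<sigma> \<in> infinite_sorts \<Sigma> A \<Longrightarrow> U \<sigma> \<subseteq> sort_dom A \<sigma> \<and> |U \<sigma>| =o |?K|"
    by metis
  \<comment> \<open>Putting \<open>U \<sigma>\<close> into every infinite sort, and not into just
    one, settles the lower bound \<open>natLeq\<close> and the equality with \<open>\<kappa>\<close>
    together.\<close>
  define Y where "Y \<sigma> = (if \<sigma> \<in> infinite_sorts \<Sigma> A then X \<sigma> \<union> U \<sigma> else sort_dom A \<sigma>)" for \<sigma>
  let ?D = "skolem_hull \<Sigma> A Y"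
  let ?B = "restrict_struct \<Sigma> A ?D"
  have dom_B: "sort_dom ?B = ?D" by (simp add: restrict_struct_def)
  have Y_sub: "Y \<sigma> \<subseteq> sort_dom A \<sigma>" if "\<sigma> \<in> sorts \<Sigma>" for \<sigma>
    using that assms(9) U by (auto simp: Y_def)
  have U_ne: "U \<sigma> \<noteq> {}" if "\<sigma> \<in> infinite_sorts \<Sigma> A" for \<sigma>
    using U[OF that] K card_of_ordIso_finite[of "U \<sigma>" ?K] by auto
  then have Y_ne: "Y \<sigma> \<noteq> {}" if "\<sigma> \<in> sorts \<Sigma>" for \<sigma>
    using that assms(3) by (auto simp: Y_def is_struct_def)
  have Y_card: "|Y \<sigma>| \<le>o |?K|" if \<sigma>: "\<sigma> \<in> sorts \<Sigma>" for \<sigma>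
  proof (cases "\<sigma> \<in> infinite_sorts \<Sigma> A")
    case True
    have "|X \<sigma>| \<le>o |?K|" using assms(9) \<sigma> le by blast
    moreover have "|U \<sigma>| \<le>o |?K|" using U[OF True] ordIso_imp_ordLeq by blast
    ultimately show ?thesis using True card_of_Un_ordLeq_infinite[OF K] by (simp add: Y_def)
  next
    case False
    then have "\<not> natLeq \<le>o |sort_dom A \<sigma>|" using \<sigma> by (simp add: infinite_sorts_def)
    then have "finite (sort_dom A \<sigma>)"
      using natLeq_ordLeq_cinfinite[of "|sort_dom A \<sigma>|"] card_of_Card_order Field_card_of
      by (metis cinfinite_def)
    then have "|sort_dom A \<sigma>| \<le>o |?K|"
      using K by (rule card_of_finite_ordLeq_infinite)
    then show ?thesis using False by (simp add: Y_def)
  qed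
  have D_le: "|?D \<sigma>| \<le>o \<kappa>" for \<sigma>
    using ordLeq_ordIso_trans[OF card_of_skolem_hull[OF K sorts funs preds Y_card] \<kappa>] .
  have Y_D: "Y \<sigma> \<subseteq> ?D \<sigma>" if "\<sigma> \<in> sorts \<Sigma>" for \<sigma> using subset_skolem_hull[OF that] .
  have D_sub: "?D \<sigma> \<subseteq> sort_dom A \<sigma>" for \<sigma>
    using skolem_hull_subset[OF assms(1,3) Y_sub] .
  have D_ge: "\<kappa> \<le>o |?D \<sigma>|" if \<sigma>: "\<sigma> \<in> infinite_sorts \<Sigma> A" for \<sigma>
  proof -
    have "\<kappa> =o |U \<sigma>|" using U[OF \<sigma>] \<kappa> ordIso_symmetric ordIso_transitive by blast
    moreover have "U \<sigma> \<subseteq> ?D \<sigma>"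
      using Y_D[of \<sigma>] \<sigma> by (auto simp: Y_def infinite_sorts_def)
    ultimately show ?thesis using card_of_mono1 ordIso_ordLeq_trans by blast
  qed
  show ?thesis
  proof (intro exI[of _ ?B] conjI ballI; (unfold dom_B)?)
    show "elementary_substructure \<Sigma> ?B A"
      by (rule skolem_hull_elementary[OF assms(1,3)]) (simp add: Y_sub Y_ne)
    \<comment> \<open>On a finite sort the generators are already the whole domain, and the hull
      stays inside it.\<close>
    show "?D \<sigma> = sort_dom A \<sigma>" if "\<sigma> \<in> finite_sorts \<Sigma> A" for \<sigma>
      using that D_sub[of \<sigma>] Y_D[of \<sigma>] by (auto simp: finite_sorts_def Y_def)
    show "natLeq \<le>o |?D \<sigma>|" if "\<sigma> \<in> infinite_sorts \<Sigma> A" for \<sigma>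
      using ordLeq_transitive[OF assms(7) D_ge[OF that]] .
    show "|?D \<sigma>| \<le>o \<kappa>" for \<sigma> by (rule D_le)
    \<comment> \<open>Any infinite sort attains \<open>\<kappa>\<close>, and the hypothesis on the
      maximum provides one.\<close>
    obtain \<sigma> where \<sigma>: "\<sigma> \<in> sorts \<Sigma>" "\<sigma> \<in> infinite_sorts \<Sigma> A"
      using assms(4) by (auto simp: infinite_sorts_def)
    then show "\<exists>\<sigma>\<in>sorts \<Sigma>. |?D \<sigma>| =o \<kappa>"
      using D_le D_ge ordIso_iff_ordLeq by blast
    show "X \<sigma> \<subseteq> ?D \<sigma>" if "\<sigma> \<in> sorts \<Sigma>" for \<sigma>
      using that Y_D[OF that] assms(9) by (auto simp: Y_def split: if_splits)
  qed
qed

end
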